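(* For every $n\ge1$, the number of local-cycle triangles of order $n$ is $$|L_n|=\frac{7^n-4^n}{3}.$$
   Context: $\Delta_n=\{i,j,k,e\}^n$ is the set of words $b=b_1b_2\cdots b_n$ of length $n$ in the four symbols $i,j,k,e$. For $b\in\Delta_n$ put $\mathrm{supp}(b)=\{r\in\{1,\dots,n\}: b_r\ne e\}$. Let $\gamma$ be the permutation $i\mapsto j\mapsto k\mapsto i$, $e\mapsto e$. For a nonempty set $S\subseteq\mathrm{supp}(b)$, let $\gamma_S(b)$ be the word obtained by applying $\gamma$ in the coordinates of $S$ and fixing the other coordinates, and let $$T(b,S)=\{b,\gamma_S(b),\gamma_S^2(b)\}$$ (an unordered set of three words). The local class is $$L_n=\{T(b,S): b\in\Delta_n,\ \varnothing\ne S\subseteq\mathrm{supp}(b)\}.$$ *)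

theory Defs
  imports Complex_Main
begin

datatype symb = Sym_i | Sym_j | Sym_k | Sym_e

primrec gam :: "symb \<Rightarrow> symb" where
  "gam Sym_i = Sym_j"
| "gam Sym_j = Sym_k"
| "gam Sym_k = Sym_i"
| "gam Sym_e = Sym_e"

definition Delta :: "nat \<Rightarrow> symb list set" where
  "Delta n = {b. length b = n}"

(* List positions start at 0, so coordinate r of a word in the usual numbering 1, ..., n
   is the position r - 1 here. *)

definition supp :: "symb list \<Rightarrow> nat set" where
  "supp b = {r. r < length b \<and> b ! r \<noteq> Sym_e}"

definition gam_on :: "nat set \<Rightarrow> symb list \<Rightarrow> symb list" where
  "gam_on S b = map (\<lambda>r. if r \<in> S then gam (b ! r) else b ! r) [0..<length b]"

definition triangle :: "symb list \<Rightarrow> nat set \<Rightarrow> symb list set" where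
  "triangle b S = {b, gam_on S b, (gam_on S ^^ 2) b}"

definition local_class :: "nat \<Rightarrow> symb list set set" where
  "local_class n = {triangle b S | b S. b \<in> Delta n \<and> S \<noteq> {} \<and> S \<subseteq> supp b}"

end

theory Submission
  imports Defs
begin

text \<open>
  The triangle \<open>T(b,S)\<close> is an orbit of \<open>\<gamma>\<^sub>S\<close>, which acts without fixed points and with order three on
  the words whose support contains the nonempty set \<open>S\<close>. The proof counts the \<^emph>\<open>marked words\<close> \<open>(b,S)\<close> with
  \<open>S \<subseteq> supp b\<close> and then divides by the number of marked words per triangle.

  A coordinate of a marked word carries either \<open>e\<close>, which has to be unmarked, or one of three letters,
  marked or not. These are seven choices, made independently, so there are \<open>7\<^sup>n\<close> marked words; the
  \<open>4\<^sup>n\<close> of them with empty mark are to be discarded (lemmas \<open>card_marked_words\<close> and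
  \<open>card_unmarked_words\<close>).

  A triangle determines its mark: \<open>S\<close> is the set of coordinates in which its words disagree
  (lemma \<open>varying_coordinates_triangle\<close>). Given \<open>S\<close>, the possible base points are the
  words of the triangle (lemma \<open>triangle_fibre\<close>), and these are three distinct words when \<open>S\<close> is
  nonempty (lemma \<open>card_triangle\<close>). So every triangle in the local class comes from exactly three
  marked words with nonempty mark, and there are \<open>7\<^sup>n - 4\<^sup>n\<close> of the latter.
\<close>

definition marked_words :: "nat \<Rightarrow> (symb list \<times> nat set) set" where
  "marked_words n = {(b, S). length b = n \<and> S \<subseteq> supp b}"

section \<open>Orbits of the partial rotation\<close>

lemma gam_gam_gam [simp]: "gam (gam (gam x)) = x"
  by (cases x) simp_all

lemma gam_eq_self_iff: "gam x = x \<longleftrightarrow> x = Sym_e"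
  by (cases x) simp_all

lemma gam_eq_Sym_e_iff: "gam x = Sym_e \<longleftrightarrow> x = Sym_e"
  by (cases x) simp_all

lemma length_gam_on [simp]: "length (gam_on S b) = length b"
  by (simp add: gam_on_def)

lemma nth_gam_on [simp]:
  "r < length b \<Longrightarrow> gam_on S b ! r = (if r \<in> S then gam (b ! r) else b ! r)"
  by (simp add: gam_on_def)

lemma gam_on_gam_on_gam_on [simp]: "gam_on S (gam_on S (gam_on S b)) = b"
  by (rule nth_equalityI) simp_all

lemma supp_gam_on [simp]: "supp (gam_on S b) = supp b"
  by (auto simp: supp_def gam_eq_Sym_e_iff split: if_splits)

lemma triangle_eq: "triangle b S = {b, gam_on S b, gam_on S (gam_on S b)}"
  by (simp add: triangle_def numeral_2_eq_2)

lemma base_in_triangle: "b \<in> triangle b S"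
  by (simp add: triangle_eq)

lemma triangle_cong_base: "c \<in> triangle b S \<Longrightarrow> triangle c S = triangle b S"
  by (auto simp: triangle_eq)

lemma length_in_triangle: "c \<in> triangle b S \<Longrightarrow> length c = length b"
  by (auto simp: triangle_eq)

lemma supp_in_triangle: "c \<in> triangle b S \<Longrightarrow> supp c = supp b"
  by (auto simp: triangle_eq)

text \<open>
  On a letter other than \<open>e\<close> neither \<open>\<gamma>\<close> nor \<open>\<gamma>\<^sup>2\<close> has a fixed point, so a single
  coordinate in \<open>S\<close> already separates the three words.
\<close>

lemma card_triangle:
  assumes "S \<noteq> {}" "S \<subseteq> supp b"
  shows "card (triangle b S) = 3"
proof -
  from assms obtain r where r: "r \<in> S" "r < length b" "b ! r \<noteq> Sym_e"
    by (auto simp: supp_def)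
  then have "b ! r \<noteq> gam_on S b ! r" "b ! r \<noteq> gam_on S (gam_on S b) ! r"
    "gam_on S b ! r \<noteq> gam_on S (gam_on S b) ! r"
    by (cases "b ! r"; simp)+
  then have "b \<noteq> gam_on S b" "b \<noteq> gam_on S (gam_on S b)" "gam_on S b \<noteq> gam_on S (gam_on S b)"
    by metis+
  then show ?thesis
    by (simp add: triangle_eq)
qed

section \<open>The mark of a triangle\<close>

text \<open>
  The right-hand side refers to the triangle alone (and to the common length of its words). So two
  marked words with the same triangle have the same mark.
\<close>

lemma varying_coordinates_triangle:
  assumes "S \<subseteq> supp b"
  shows "S = {r. r < length b \<and> (\<exists>x\<in>triangle b S. \<exists>y\<in>triangle b S. x ! r \<noteq> y ! r)}"
    (is "S = ?V")
proof
  show "S \<subseteq> ?V"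
  proof
    fix r assume "r \<in> S"
    with assms have r: "r < length b" "b ! r \<noteq> Sym_e"
      by (auto simp: supp_def)
    then have "b ! r \<noteq> gam_on S b ! r"
      using \<open>r \<in> S\<close> gam_eq_self_iff[of "b ! r"] by simp
    with r show "r \<in> ?V"
      by (auto simp: triangle_eq)
  qed
  show "?V \<subseteq> S"
    by (auto simp: triangle_eq split: if_splits)
qed

lemma mark_eq_of_triangle_eq:
  assumes "S \<subseteq> supp b" "U \<subseteq> supp c" "triangle c U = triangle b S"
  shows "U = S"
proof -
  have "length c = length b"
    using length_in_triangle[of c b S] base_in_triangle[of c U] assms(3) by simp
  with assms show ?thesis
    using varying_coordinates_triangle[of S b] varying_coordinates_triangle[of U c] by simp
qed

lemma triangle_fibre:
  assumes "length b = n" "S \<noteq> {}" "S \<subseteq> supp b"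
  shows "{p \<in> marked_words n - UNIV \<times> {{}}. case_prod triangle p = triangle b S}
           = triangle b S \<times> {S}" (is "?F = _")
proof (intro equalityI subsetI)
  fix p assume "p \<in> ?F"
  then obtain c U where p: "p = (c, U)" "U \<subseteq> supp c" "triangle c U = triangle b S"
    by (auto simp: marked_words_def)
  then show "p \<in> triangle b S \<times> {S}"
    using mark_eq_of_triangle_eq[OF assms(3)] base_in_triangle[of c U] by auto
next
  fix p assume "p \<in> triangle b S \<times> {S}"
  then obtain c where p: "p = (c, S)" "c \<in> triangle b S"
    by auto
  then show "p \<in> ?F"
    using assms length_in_triangle[OF p(2)] supp_in_triangle[OF p(2)] triangle_cong_base[OF p(2)]
    by (simp add: marked_words_def)
qed

lemma local_class_eq_image:
  "local_class n = case_prod triangle ` (marked_words n - UNIV \<times> {{}})"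
  by (force simp: local_class_def Delta_def marked_words_def)

section \<open>Counting marked words\<close>

lemma UNIV_symb: "(UNIV :: symb set) = {Sym_i, Sym_j, Sym_k, Sym_e}"
  using symb.exhaust by blast

lemma finite_UNIV_symb: "finite (UNIV :: symb set)"
  by (simp add: UNIV_symb)

lemma card_UNIV_symb: "card (UNIV :: symb set) = 4"
  by (simp add: UNIV_symb)

text \<open>
  A marked word is a word over the alphabet of letters with a Boolean mark, where \<open>e\<close> may not be
  marked.
\<close>

lemma card_marked_words: "card (marked_words n) = 7 ^ n"
proof -
  define A where "A = {(x, m). m \<longrightarrow> x \<noteq> Sym_e}"
  define f where "f xs = (map fst xs, {r. r < length xs \<and> snd (xs ! r)})"
    for xs :: "(symb \<times> bool) list"
  define g where "g = (\<lambda>(b :: symb list, S). map (\<lambda>r. (b ! r, r \<in> S)) [0..<length b])"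
  have A: "A = {(Sym_i, False), (Sym_j, False), (Sym_k, False), (Sym_e, False),
                (Sym_i, True), (Sym_j, True), (Sym_k, True)}" (is "A = ?A7")
  proof (intro set_eqI)
    fix p :: "symb \<times> bool"
    obtain x m where "p = (x, m)"
      by (cases p)
    then show "p \<in> A \<longleftrightarrow> p \<in> ?A7"
      by (cases x; cases m) (simp_all add: A_def)
  qed
  have "bij_betw f {xs. set xs \<subseteq> A \<and> length xs = n} (marked_words n)"
  proof (rule bij_betw_byWitness[where f' = g])
    show "\<forall>xs\<in>{xs. set xs \<subseteq> A \<and> length xs = n}. g (f xs) = xs"
      by (auto simp: f_def g_def intro!: nth_equalityI)
    show "\<forall>p\<in>marked_words n. f (g p) = p"
      by (auto simp: f_def g_def marked_words_def supp_def intro!: nth_equalityI)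
    show "f ` {xs. set xs \<subseteq> A \<and> length xs = n} \<subseteq> marked_words n"
    proof (rule image_subsetI)
      fix xs assume xs: "xs \<in> {xs. set xs \<subseteq> A \<and> length xs = n}"
      then have "xs ! r \<in> A" if "r < length xs" for r
        using that nth_mem by blast
      then show "f xs \<in> marked_words n"
        using xs by (auto simp: f_def marked_words_def supp_def A_def case_prod_beta)
    qed
    show "g ` marked_words n \<subseteq> {xs. set xs \<subseteq> A \<and> length xs = n}"
    proof (rule image_subsetI)
      fix p assume "p \<in> marked_words n"
      then obtain b S where p: "p = (b, S)" and len: "length b = n" and "S \<subseteq> supp b"
        by (auto simp: marked_words_def)
      then have "(b ! r, r \<in> S) \<in> A" for r
        by (auto simp: A_def supp_def)
      then show "g p \<in> {xs. set xs \<subseteq> A \<and> length xs = n}"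
        using p len by (auto simp: g_def)
    qed
  qed
  moreover have "card {xs. set xs \<subseteq> A \<and> length xs = n} = card A ^ n"
    by (rule card_lists_length_eq) (simp add: A)
  moreover have "card A = 7"
    by (simp add: A)
  ultimately show ?thesis
    using bij_betw_same_card by metis
qed

lemma finite_marked_words: "finite (marked_words n)"
  by (rule card_ge_0_finite) (simp add: card_marked_words)

lemma card_unmarked_words: "card (marked_words n \<inter> UNIV \<times> {{}}) = 4 ^ n"
proof -
  have "marked_words n \<inter> UNIV \<times> {{}} = {b :: symb list. set b \<subseteq> UNIV \<and> length b = n} \<times> {{}}"
    by (auto simp: marked_words_def)
  moreover have "card {b :: symb list. set b \<subseteq> UNIV \<and> length b = n} = 4 ^ n"
    using card_lists_length_eq[of "UNIV :: symb set" n] finite_UNIV_symb card_UNIV_symb by simp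
  ultimately show ?thesis
    by (simp add: card_cartesian_product)
qed

section \<open>The local class\<close>

lemma card_local_class: "3 * card (local_class n) + 4 ^ n = 7 ^ n"
proof -
  let ?P = "marked_words n - UNIV \<times> {{}}"
  have fin: "finite ?P"
    using finite_marked_words by blast
  have fibre: "card {p \<in> ?P. case_prod triangle p = t} = 3" if t: "t \<in> local_class n" for t
  proof -
    from t obtain b S where "t = triangle b S" "length b = n" "S \<noteq> {}" "S \<subseteq> supp b"
      by (auto simp: local_class_def Delta_def)
    then show ?thesis
      by (simp add: triangle_fibre card_cartesian_product card_triangle del: mem_Sigma_iff Diff_iff)
  qed
  have "card ?P = (\<Sum>p\<in>?P. 1)"
    by simp
  also have "\<dots> = (\<Sum>t\<in>local_class n. card {p \<in> ?P. case_prod triangle p = t})"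
    unfolding card_eq_sum local_class_eq_image by (rule sum.image_gen[OF fin])
  also have "\<dots> = 3 * card (local_class n)"
    using fibre by simp
  finally have "card ?P = 3 * card (local_class n)" .
  moreover have "card (marked_words n) = card ?P + card (marked_words n \<inter> UNIV \<times> {{}})"
    using card_Int_Diff[OF finite_marked_words[of n], of "UNIV \<times> {{}}"] by simp
  ultimately show ?thesis
    by (simp add: card_marked_words card_unmarked_words)
qed

theorem theorem5p8:
  fixes n :: nat
  assumes "n \<ge> 1"
  shows "real (card (local_class n)) = (7 ^ n - 4 ^ n) / 3"
proof -
  have "real (3 * card (local_class n) + 4 ^ n) = real (7 ^ n)"
    by (simp only: card_local_class)
  then show ?thesis
    by simp
qed

end
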